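(* Let $\Omega$ be a nonempty closed subset of $\mathbb{R}^n$, let $I=\{1,\ldots,m\}$, $J=\{1,\ldots,p\}$, and let $f_i:\mathbb{R}^n\to\mathbb{R}$ ($i\in I$) and $g_j:\mathbb{R}^n\to\mathbb{R}$ ($j\in J$) be lower semicontinuous functions that are Lipschitz at infinity. Let $f=(f_1,\ldots,f_m)$ and $\mathcal{F}=\{x\in\Omega: g_j(x)\le 0,\ j\in J\}$. Assume that $\mathcal{F}$ is nonempty and unbounded and that $\max_{i\in I}f_i$ is bounded from below on $\mathcal{F}$. Let $\bar y$ be a weak Pareto value of the vector optimization problem $\mathrm{Min}_{\mathbb{R}^m_+}\{f(x): x\in\mathcal{F}\}$. Assume that the constraint qualification (CQ) holds at infinity: there do not exist $\beta_j\ge 0$, $j\in J$, such that $\sum_{j\in J}\beta_j>0$ and $0\in\sum_{j\in J}\beta_j\partial g_j(\infty)+N_\Omega(\infty)$. If there is a sequence $(x_k)$ in $\mathcal{F}$ with $\|x_k\|\to\infty$ such that $f(x_k)\to\bar y$, then there exist $\alpha=(\alpha_1,\ldots,\alpha_m)\in\mathbb{R}^m_+\setminus\{0\}$ and $\beta=(\beta_1,\ldots,\beta_p)\in\mathbb{R}^p_+$ such that $$0\in\sum_{i\in I}\alpha_i\partial f_i(\infty)+\sum_{j\in J}\beta_j\partial g_j(\infty)+N_\Omega(\infty).$$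
   Context: $\mathbb{R}^n$ carries the Euclidean inner product and norm; $\mathbb{B}_R$ is the closed ball of radius $R$ centered at the origin; $\mathrm{epi}\, h=\{(x,\alpha)\in\mathbb{R}^n\times\mathbb{R}:\alpha\ge h(x)\}$; $\mathbb{R}^m_+$ is the nonnegative orthant of $\mathbb{R}^m$. Sums and scalar multiples of sets are in the Minkowski sense. A point $y\in\mathrm{cl}\, f(\mathcal{F})$ (closure in $\mathbb{R}^m$) is a weak Pareto value of the problem $\mathrm{Min}_{\mathbb{R}^m_+}\{f(x):x\in\mathcal{F}\}$ if $f(\mathcal{F})\cap(y-\mathrm{int}\,\mathbb{R}^m_+)=\emptyset$. A lower semicontinuous function $h:\mathbb{R}^n\to\mathbb{R}$ is Lipschitz at infinity if there exist $L>0$, $R>0$ with $|h(x)-h(x')|\le L\|x-x'\|$ for all $x,x'\in\mathbb{R}^n\setminus\mathbb{B}_R$. For a set $D\subset\mathbb{R}^d$ and $\bar x\in D$, the Fréchet normal cone is $\widehat N_D(\bar x)=\{v\in\mathbb{R}^d:\limsup_{x\to\bar x,\,x\in D}\langle v,x-\bar x\rangle/\|x-\bar x\|\le 0\}$, and the limiting (Mordukhovich) normal cone $N_D(\bar x)$ is the set of all $v$ for which there exist $x_k\in D$, $x_k\to\bar x$, and $v_k\in\widehat N_D(x_k)$ with $v_k\to v$. Normal cone at infinity: for an unbounded closed set $\Omega\subset\mathbb{R}^n$, $N_\Omega(\infty)$ is the set of all $v\in\mathbb{R}^n$ for which there exist $x_k\in\Omega$ with $\|x_k\|\to\infty$ and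 $v_k\in\widehat N_\Omega(x_k)$ with $v_k\to v$. Limiting subdifferential at infinity: for a lower semicontinuous $h:\mathbb{R}^n\to\mathbb{R}$, $\partial h(\infty)$ is the set of all $u\in\mathbb{R}^n$ for which there exist $x_k\in\mathbb{R}^n$ with $\|x_k\|\to\infty$ and $w_k\in N_{\mathrm{epi}\, h}(x_k,h(x_k))$ with $w_k\to(u,-1)$. *)

theory Defs
  imports "HOL-Analysis.Analysis"
begin

definition lower_semicontinuous :: "('a::topological_space \<Rightarrow> real) \<Rightarrow> bool" where
  "lower_semicontinuous h \<longleftrightarrow> (\<forall>x. \<forall>c<h x. \<forall>\<^sub>F y in nhds x. c < h y)"

definition lipschitz_at_infinity :: "('a::real_normed_vector \<Rightarrow> real) \<Rightarrow> bool" where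
  "lipschitz_at_infinity h \<longleftrightarrow> (\<exists>L>0. \<exists>R>0. L-lipschitz_on (- cball 0 R) h)"

text \<open>
  The limsup is taken in the extended reals, over the punctured neighbourhoods of \<open>a\<close> in \<open>D\<close>.
  At an isolated point of \<open>D\<close> it is \<open>-\<infinity>\<close>, so the cone is the whole space there.
  Both cones below are meant for base points in \<open>D\<close>.
\<close>
definition frechet_normal_cone :: "'a::real_inner set \<Rightarrow> 'a \<Rightarrow> 'a set" where
  "frechet_normal_cone D a =
     {v. Limsup (at a within D) (\<lambda>x. ereal (v \<bullet> (x - a) / norm (x - a))) \<le> 0}"

definition limiting_normal_cone :: "'a::real_inner set \<Rightarrow> 'a \<Rightarrow> 'a set" where
  "limiting_normal_cone D a =
     {v. \<exists>x w. (\<forall>k::nat. x k \<in> D \<and> w k \<in> frechet_normal_cone D (x k)) \<and>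
               x \<longlonglongrightarrow> a \<and> w \<longlonglongrightarrow> v}"

definition normal_cone_at_infinity :: "'a::real_inner set \<Rightarrow> 'a set" where
  "normal_cone_at_infinity \<Omega> =
     {v. \<exists>x w. (\<forall>k::nat. x k \<in> \<Omega> \<and> w k \<in> frechet_normal_cone \<Omega> (x k)) \<and>
               filterlim (\<lambda>k. norm (x k)) at_top sequentially \<and> w \<longlonglongrightarrow> v}"

definition subdifferential_at_infinity :: "('a::real_inner \<Rightarrow> real) \<Rightarrow> 'a set" where
  "subdifferential_at_infinity h =
     {u. \<exists>x w. (\<forall>k::nat. w k \<in> limiting_normal_cone (epigraph UNIV h) (x k, h (x k))) \<and>
               filterlim (\<lambda>k. norm (x k)) at_top sequentially \<and> w \<longlonglongrightarrow> (u, -1)}"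

definition nonneg_orthant :: "(real ^ 'm) set" where
  "nonneg_orthant = {z. \<forall>i. 0 \<le> z $ i}"

definition weak_pareto_value :: "('a \<Rightarrow> real ^ 'm) \<Rightarrow> 'a set \<Rightarrow> real ^ 'm \<Rightarrow> bool" where
  "weak_pareto_value f F y \<longleftrightarrow>
     y \<in> closure (f ` F) \<and> f ` F \<inter> (\<lambda>z. y - z) ` interior nonneg_orthant = {}"

definition feasible_set :: "'a set \<Rightarrow> nat \<Rightarrow> (nat \<Rightarrow> 'a \<Rightarrow> real) \<Rightarrow> 'a set" where
  "feasible_set \<Omega> p g = {x \<in> \<Omega>. \<forall>j\<in>{1..p}. g j x \<le> 0}"

text \<open>
  Sums of sets, written with \<open>+\<close> and \<open>\<Sum>\<close>, are Minkowski sums (as in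
  \<^theory>\<open>HOL-Library.Set_Algebras\<close>); an empty sum is \<open>{0}\<close>.
\<close>
abbreviation set_scale :: "real \<Rightarrow> 'a::real_vector set \<Rightarrow> 'a set" where
  "set_scale c A \<equiv> (\<lambda>v. c *\<^sub>R v) ` A"

definition cq_at_infinity :: "'a::real_inner set \<Rightarrow> nat \<Rightarrow> (nat \<Rightarrow> 'a \<Rightarrow> real) \<Rightarrow> bool" where
  "cq_at_infinity \<Omega> p g \<longleftrightarrow>
     \<not> (\<exists>\<beta>::nat \<Rightarrow> real. (\<forall>j\<in>{1..p}. 0 \<le> \<beta> j) \<and> (\<Sum>j\<in>{1..p}. \<beta> j) > 0 \<and>
          0 \<in> (\<Sum>j\<in>{1..p}. set_scale (\<beta> j) (subdifferential_at_infinity (g j)))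
               + normal_cone_at_infinity \<Omega>)"

end

theory Submission
  imports Defs
begin

text \<open>
  Put \<open>\<psi> = max (max\<^sub>i (f\<^sub>i - ybar\<^sub>i)) (max\<^sub>j g\<^sub>j)\<close>. That \<open>ybar\<close> is a weak Pareto value gives
  \<open>\<psi> \<ge> 0\<close> on \<open>\<Omega>\<close>: a point of \<open>\<Omega>\<close> with \<open>\<psi> < 0\<close> would be feasible and strictly better than \<open>ybar\<close> in
  every objective. Along the given sequence of feasible points the upper limit of \<open>\<psi>\<close> is at most \<open>0\<close>,
  so its far terms are approximate minimisers of \<open>\<psi>\<close> on \<open>\<Omega>\<close>, in a region where all functions involved
  are Lipschitz with one constant \<open>L\<close>. A Fermat rule for \<open>\<psi>\<close> at such points, with multipliers of
  sum \<open>1\<close>, survives the passage to infinity, since multipliers and subgradients stay bounded. If all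
  multipliers of the objectives vanished in the limit, those of the constraints would have sum \<open>1\<close> and
  contradict the constraint qualification.

  The Fermat rule at finite points is obtained from one exact minimisation, which takes the place of
  a variational principle and of sum and maximum rules for limiting subdifferentials. Write
  \<open>h\<^sub>1, \<dots>, h\<^sub>N\<close> for the functions under the maximum and let \<open>a\<close> be an approximate minimiser. Give every
  function its own variable, replace the maximum by the smooth function log-sum-exp, and minimise
    \<open>\<tau> ln (\<Sum>\<^sub>i exp (h\<^sub>i y\<^sub>i / \<tau>)) + c/2 \<Sum>\<^sub>i \<parallel>x - y\<^sub>i\<parallel>\<^sup>2 + 1/2 \<parallel>x - a\<parallel>\<^sup>2\<close>
  over \<open>x \<in> \<Omega>\<close> and \<open>y\<close> near \<open>a\<close>, which is a compact problem. For small \<open>\<tau>\<close> and large \<open>c\<close> the minimiser lies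
  close to \<open>a\<close> (\<open>penalised_min_localised\<close>), so it is interior to the balls that bound the search and the
  optimality conditions can be read off one variable at a time. In \<open>y\<^sub>i\<close>, the vector \<open>c (x - y\<^sub>i)\<close> is a
  subgradient of a smooth increasing function of \<open>h\<^sub>i\<close> with derivative \<open>l\<^sub>i > 0\<close>, the softmax weight, so
  \<open>u\<^sub>i = c (x - y\<^sub>i) / l\<^sub>i\<close> is a subgradient of \<open>h\<^sub>i\<close> (\<open>penalised_min_subgradient\<close>). In \<open>x\<close>, only a smooth
  function is minimised on \<open>\<Omega>\<close>, so \<open>- \<Sum>\<^sub>i c (x - y\<^sub>i) - (x - a)\<close>, which is \<open>- \<Sum>\<^sub>i l\<^sub>i u\<^sub>i\<close> up to a small error, is
  normal to \<open>\<Omega>\<close> (\<open>penalised_min_normal\<close>). The limit is taken in \<open>multiplier_rule_at_infinity\<close>.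
\<close>

section \<open>Frechet subgradients and normals\<close>

text \<open>
  Subgradients are described by the difference quotient rather than through the epigraph, so that
  adding a constant to \<open>h\<close> changes nothing; the link with normals to the epigraph is
  \<open>frechet_subgradient_epigraph_normal\<close>.
\<close>
definition frechet_subgradient :: "('a::real_inner \<Rightarrow> real) \<Rightarrow> 'a \<Rightarrow> 'a \<Rightarrow> bool" where
  "frechet_subgradient h a u \<longleftrightarrow>
     (\<forall>e>0. \<forall>\<^sub>F z in nhds a. u \<bullet> (z - a) - e * norm (z - a) \<le> h z - h a)"

lemma frechet_normal_coneI:
  assumes "\<And>e. e > 0 \<Longrightarrow> \<forall>\<^sub>F x in at a within D. v \<bullet> (x - a) \<le> e * norm (x - a)"
  shows "v \<in> frechet_normal_cone D a"
  unfolding frechet_normal_cone_def mem_Collect_eq Limsup_le_iff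
proof (intro allI impI)
  fix y :: ereal assume "y > 0"
  then obtain e where e: "0 < ereal e" "ereal e < y"
    using ereal_dense2 by blast
  have "\<forall>\<^sub>F x in at a within D. v \<bullet> (x - a) \<le> e * norm (x - a)"
    using assms e by simp
  then show "\<forall>\<^sub>F x in at a within D. ereal (v \<bullet> (x - a) / norm (x - a)) < y"
  proof (rule eventually_mono)
    fix x assume "v \<bullet> (x - a) \<le> e * norm (x - a)"
    then have "v \<bullet> (x - a) / norm (x - a) \<le> e"
      using e by (cases "x = a") (auto simp: divide_simps mult.commute)
    then show "ereal (v \<bullet> (x - a) / norm (x - a)) < y"
      using e by (metis ereal_less_eq(3) order_le_less_trans)
  qed
qed

lemma eventually_nhds_le_linear:
  fixes a :: "'a::real_normed_vector"
  assumes "e > 0"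
  shows "\<forall>\<^sub>F z in nhds a. M * (norm (z - a))\<^sup>2 \<le> e * norm (z - a)"
proof -
  have "\<forall>\<^sub>F z in nhds a. dist z a < e / (\<bar>M\<bar> + 1)"
    using assms by (intro eventually_nhds_metric[THEN iffD2] exI[of _ "e / (\<bar>M\<bar> + 1)"]) auto
  then show ?thesis
  proof (rule eventually_mono)
    fix z assume "dist z a < e / (\<bar>M\<bar> + 1)"
    then have "norm (z - a) * (\<bar>M\<bar> + 1) \<le> e"
      by (simp add: dist_norm field_simps)
    moreover have "M * norm (z - a) \<le> norm (z - a) * (\<bar>M\<bar> + 1)"
      by (metis abs_ge_self add_increasing2 mult.commute mult_right_mono norm_ge_zero zero_le_one)
    ultimately have "M * norm (z - a) \<le> e" by linarith
    then have "(M * norm (z - a)) * norm (z - a) \<le> e * norm (z - a)"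
      by (intro mult_right_mono) auto
    then show "M * (norm (z - a))\<^sup>2 \<le> e * norm (z - a)"
      by (simp add: power2_eq_square mult.assoc)
  qed
qed

text \<open>
  Optimality against a quadratic penalty yields inequalities with a quadratic error. This lemma and
  the next turn them into Frechet normals and subgradients, where an error \<open>o(\<parallel>x - a\<parallel>)\<close> is allowed.
\<close>
lemma proximal_normal_in_frechet_normal_cone:
  assumes "\<forall>\<^sub>F x in nhds a. x \<in> D \<longrightarrow> v \<bullet> (x - a) \<le> M * (norm (x - a))\<^sup>2"
  shows "v \<in> frechet_normal_cone D a"
proof (rule frechet_normal_coneI)
  fix e :: real assume "e > 0"
  have "\<forall>\<^sub>F x in nhds a. x \<in> D \<longrightarrow> v \<bullet> (x - a) \<le> e * norm (x - a)"
    using assms eventually_nhds_le_linear[OF \<open>e > 0\<close>, of M a]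
    by eventually_elim auto
  then show "\<forall>\<^sub>F x in at a within D. v \<bullet> (x - a) \<le> e * norm (x - a)"
    unfolding eventually_at_filter by (rule eventually_mono) auto
qed

lemma proximal_subgradient_imp_frechet_subgradient:
  assumes "\<forall>\<^sub>F z in nhds a. u \<bullet> (z - a) - M * (norm (z - a))\<^sup>2 \<le> h z - h a"
  shows "frechet_subgradient h a u"
  unfolding frechet_subgradient_def
proof (intro allI impI)
  fix e :: real assume "e > 0"
  show "\<forall>\<^sub>F z in nhds a. u \<bullet> (z - a) - e * norm (z - a) \<le> h z - h a"
    using assms eventually_nhds_le_linear[OF \<open>e > 0\<close>, of M a]
    by eventually_elim auto
qed

lemma frechet_subgradient_epigraph_normal:
  assumes "frechet_subgradient h a u"
  shows "(u, -1) \<in> frechet_normal_cone (epigraph UNIV h) (a, h a)"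
proof (rule frechet_normal_coneI)
  fix e :: real assume "e > 0"
  have "\<forall>\<^sub>F z in nhds a. u \<bullet> (z - a) - e * norm (z - a) \<le> h z - h a"
    using assms \<open>e > 0\<close> by (auto simp: frechet_subgradient_def)
  moreover have "filterlim fst (nhds a) (nhds (a, h a))"
    using tendsto_fst[OF filterlim_ident, of "(a, h a)"] by simp
  ultimately have "\<forall>\<^sub>F q in nhds (a, h a). u \<bullet> (fst q - a) - e * norm (fst q - a) \<le> h (fst q) - h a"
    by (auto simp: filterlim_iff)
  then show "\<forall>\<^sub>F q in at (a, h a) within epigraph UNIV h.
      (u, -1) \<bullet> (q - (a, h a)) \<le> e * norm (q - (a, h a))"
    unfolding eventually_at_filter
  proof (rule eventually_mono, intro impI)
    fix q assume q: "u \<bullet> (fst q - a) - e * norm (fst q - a) \<le> h (fst q) - h a"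
      and "q \<in> epigraph UNIV h"
    then have "h (fst q) \<le> snd q" by (simp add: epigraph_def)
    moreover have "norm (fst q - a) \<le> norm (q - (a, h a))"
      by (metis fst_conv fst_diff norm_fst_le prod.collapse)
    then have "e * norm (fst q - a) \<le> e * norm (q - (a, h a))"
      using \<open>e > 0\<close> by simp
    moreover have "(u, -1) \<bullet> (q - (a, h a)) = u \<bullet> (fst q - a) - (snd q - h a)"
      by (cases q) (simp add: inner_diff)
    ultimately show "(u, -1) \<bullet> (q - (a, h a)) \<le> e * norm (q - (a, h a))"
      using q by linarith
  qed
qed

text \<open>
  Move from \<open>a\<close> a short way in the direction \<open>u\<close> itself: \<open>h\<close> then grows at the rate \<open>\<parallel>u\<parallel>\<close> at least,
  and at the rate \<open>L\<close> at most. This bound is what makes the subgradients converge along a subsequence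
  even where the multipliers tend to \<open>0\<close>.
\<close>
lemma frechet_subgradient_norm_le:
  fixes h :: "'a::real_inner \<Rightarrow> real"
  assumes "frechet_subgradient h a u"
    and lip: "\<forall>\<^sub>F z in nhds a. \<bar>h z - h a\<bar> \<le> L * norm (z - a)"
    and "L \<ge> 0"
  shows "norm u \<le> L"
proof (rule field_le_epsilon)
  fix e :: real assume "e > 0"
  show "norm u \<le> L + e"
  proof (cases "u = 0")
    case True
    then show ?thesis using \<open>L \<ge> 0\<close> \<open>e > 0\<close> by simp
  next
    case False
    have "\<forall>\<^sub>F z in nhds a. u \<bullet> (z - a) - e * norm (z - a) \<le> L * norm (z - a)"
      using assms(1)[unfolded frechet_subgradient_def, rule_format, OF \<open>e > 0\<close>] lip
      by eventually_elim auto
    moreover have "((\<lambda>t::real. a + t *\<^sub>R u) \<longlongrightarrow> a) (at_right 0)"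
      by (rule tendsto_eq_intros refl | simp)+
    ultimately have "\<forall>\<^sub>F t in at_right 0.
        u \<bullet> ((a + t *\<^sub>R u) - a) - e * norm ((a + t *\<^sub>R u) - a) \<le> L * norm ((a + t *\<^sub>R u) - a)"
      by (auto simp: filterlim_iff)
    then have "\<forall>\<^sub>F t in at_right (0::real).
        t > 0 \<and> u \<bullet> ((a + t *\<^sub>R u) - a) - e * norm ((a + t *\<^sub>R u) - a) \<le> L * norm ((a + t *\<^sub>R u) - a)"
      using eventually_at_right_less[of "0::real"] by eventually_elim auto
    then obtain t :: real where t: "t > 0"
      "u \<bullet> ((a + t *\<^sub>R u) - a) - e * norm ((a + t *\<^sub>R u) - a) \<le> L * norm ((a + t *\<^sub>R u) - a)"
      using eventually_happens trivial_limit_at_right_real by blast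
    then have "(t * norm u) * norm u \<le> (t * norm u) * (L + e)"
      by (simp add: algebra_simps power2_eq_square dot_square_norm)
    then show ?thesis using t False by (simp add: mult_le_cancel_left)
  qed
qed

text \<open>
  A chain rule in the unusual direction, from \<open>q \<circ> h\<close> back to \<open>h\<close>. Linearising \<open>q\<close> at \<open>h a\<close> costs
  \<open>o(\<bar>h z - h a\<bar>)\<close>, which the Lipschitz estimate makes \<open>o(\<parallel>z - a\<parallel>)\<close>; since \<open>l > 0\<close> one may divide by \<open>l\<close>.
\<close>
lemma frechet_subgradient_outer_derivative:
  fixes h :: "'a::real_inner \<Rightarrow> real"
  assumes der: "(q has_real_derivative l) (at (h a))" and "l > 0"
    and lip: "\<forall>\<^sub>F z in nhds a. \<bar>h z - h a\<bar> \<le> L * norm (z - a)" and "L \<ge> 0"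
    and sub: "frechet_subgradient (\<lambda>z. q (h z)) a w"
  shows "frechet_subgradient h a (w /\<^sub>R l)"
  unfolding frechet_subgradient_def
proof (intro allI impI)
  fix e :: real assume "e > 0"
  \<comment> \<open>An error \<open>d\<close> in the subgradient inequality and another \<open>d L\<close> from linearising \<open>q\<close> add up to \<open>e l\<close>.\<close>
  define d where "d = e * l / (1 + L)"
  have d: "d > 0" "d + d * L = e * l"
  proof -
    show "d > 0" using \<open>e > 0\<close> \<open>l > 0\<close> \<open>L \<ge> 0\<close> by (simp add: d_def)
    have "d * (1 + L) = e * l" using \<open>L \<ge> 0\<close> by (simp add: d_def)
    then show "d + d * L = e * l" by (simp add: distrib_left)
  qed
  have "(q has_derivative (\<lambda>s. l * s)) (at (h a))"
    using der by (simp add: has_field_derivative_def)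
  then obtain r where r: "r > 0"
    "\<And>s. norm (s - h a) < r \<Longrightarrow> norm (q s - q (h a) - l * (s - h a)) \<le> d * norm (s - h a)"
    using d(1) unfolding has_derivative_at_alt by blast
  have "((\<lambda>z. L * norm (z - a)) \<longlongrightarrow> L * norm (a - a)) (nhds a)"
    by (intro tendsto_intros filterlim_ident)
  then have "\<forall>\<^sub>F z in nhds a. L * norm (z - a) < r"
    using r(1) by (intro order_tendstoD) auto
  with lip sub[unfolded frechet_subgradient_def, rule_format, OF d(1)]
  show "\<forall>\<^sub>F z in nhds a. (w /\<^sub>R l) \<bullet> (z - a) - e * norm (z - a) \<le> h z - h a"
  proof eventually_elim
    case (elim z)
    have "\<bar>q (h z) - q (h a) - l * (h z - h a)\<bar> \<le> d * \<bar>h z - h a\<bar>"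
      using r(2)[of "h z"] elim by auto
    moreover have "d * \<bar>h z - h a\<bar> \<le> d * (L * norm (z - a))"
      using d elim by (intro mult_left_mono) auto
    ultimately have "w \<bullet> (z - a) - (d + d * L) * norm (z - a) \<le> l * (h z - h a)"
      using elim by (simp add: algebra_simps)
    then have "w \<bullet> (z - a) - e * l * norm (z - a) \<le> l * (h z - h a)"
      using d by simp
    then have "(w \<bullet> (z - a) - e * l * norm (z - a)) / l \<le> (l * (h z - h a)) / l"
      using \<open>l > 0\<close> by (intro divide_right_mono) auto
    then show ?case
      using \<open>l > 0\<close> by (simp add: diff_divide_distrib inverse_eq_divide)
  qed
qed

text \<open>
  Frechet normals to the epigraph are limiting normals (take a constant sequence), so Frechet
  subgradients at points going to infinity are enough to reach the subdifferential at infinity.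
\<close>
lemma subdifferential_at_infinityI:
  assumes "\<And>k. frechet_subgradient h (x k) (u k)"
    and "filterlim (\<lambda>k. norm (x k)) at_top sequentially" and "u \<longlonglongrightarrow> ulim"
  shows "ulim \<in> subdifferential_at_infinity h"
proof -
  have "(u k, -1) \<in> limiting_normal_cone (epigraph UNIV h) (x k, h (x k))" for k
    unfolding limiting_normal_cone_def mem_Collect_eq
    using frechet_subgradient_epigraph_normal[OF assms(1)[of k]]
    by (intro exI[of _ "\<lambda>_. (x k, h (x k))"] exI[of _ "\<lambda>_. (u k, -1)"]) (simp add: epigraph_def)
  moreover have "(\<lambda>k. (u k, -1::real)) \<longlonglongrightarrow> (ulim, -1)"
    by (intro tendsto_intros assms)
  ultimately show ?thesis
    unfolding subdifferential_at_infinity_def mem_Collect_eq using assms(2)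
    by (intro exI[of _ x] exI[of _ "\<lambda>k. (u k, -1)"]) simp
qed

section \<open>A multiplier rule near an approximate minimiser\<close>

text \<open>
  Log-sum-exp exceeds the maximum by at most \<open>\<tau> ln N\<close> and is smooth with strictly positive partial
  derivatives. Both properties matter: the first keeps approximate minimisers of the maximum
  approximately minimal, the second allows division by the multipliers.
\<close>
lemma le_softmax:
  fixes s :: "'i \<Rightarrow> real"
  assumes "finite I" "i \<in> I" "\<tau> > 0"
  shows "s i \<le> \<tau> * ln (\<Sum>j\<in>I. exp (s j / \<tau>))"
proof -
  have le: "exp (s i / \<tau>) \<le> (\<Sum>j\<in>I. exp (s j / \<tau>))"
    using assms by (intro member_le_sum[where f = "\<lambda>j. exp (s j / \<tau>)"]) auto
  then have "s i / \<tau> \<le> ln (\<Sum>j\<in>I. exp (s j / \<tau>))"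
    by (metis exp_gt_zero ln_exp ln_mono order_less_le_trans)
  then show ?thesis using assms by (simp add: field_simps)
qed

lemma softmax_le:
  fixes s :: "'i \<Rightarrow> real"
  assumes "finite I" "I \<noteq> {}" "\<tau> > 0" and "\<And>i. i \<in> I \<Longrightarrow> s i \<le> b"
  shows "\<tau> * ln (\<Sum>j\<in>I. exp (s j / \<tau>)) \<le> b + \<tau> * ln (card I)"
proof -
  have "(\<Sum>j\<in>I. exp (s j / \<tau>)) \<le> (\<Sum>j\<in>I. exp (b / \<tau>))"
    using assms by (intro sum_mono) (auto intro!: divide_right_mono)
  moreover have "(\<Sum>j\<in>I. exp (s j / \<tau>)) > 0"
    using assms by (intro sum_pos) auto
  ultimately have "ln (\<Sum>j\<in>I. exp (s j / \<tau>)) \<le> ln (real (card I) * exp (b / \<tau>))"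
    by (intro ln_mono) auto
  also have "\<dots> = ln (card I) + b / \<tau>"
    using assms by (subst ln_mult) (auto simp: card_gt_0_iff)
  finally have "\<tau> * ln (\<Sum>j\<in>I. exp (s j / \<tau>)) \<le> \<tau> * (ln (card I) + b / \<tau>)"
    using assms by (intro mult_left_mono) auto
  also have "\<dots> = b + \<tau> * ln (card I)"
    using \<open>\<tau> > 0\<close> by (simp add: distrib_left)
  finally show ?thesis .
qed

lemma norm_diff_square_expansion:
  fixes w x y :: "'a::real_inner"
  shows "(norm (w - y))\<^sup>2 = (norm (x - y))\<^sup>2 + 2 * ((x - y) \<bullet> (w - x)) + (norm (w - x))\<^sup>2"
  by (simp add: power2_norm_eq_inner inner_diff inner_commute algebra_simps)

lemma compact_Pi_UNIV:
  assumes "\<And>i. compact (K i)"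
  shows "compact {y. \<forall>i. y i \<in> K i}"
proof -
  have "compactin (product_topology (\<lambda>_. euclidean) UNIV) (PiE UNIV K)"
    using assms by (subst compactin_PiE) auto
  then have "compact (PiE UNIV K)"
    by (simp add: euclidean_product_topology)
  moreover have "PiE UNIV K = {y. \<forall>i. y i \<in> K i}" by auto
  ultimately show ?thesis by simp
qed

definition penalised :: "real \<Rightarrow> real \<Rightarrow> 'i set \<Rightarrow> ('i \<Rightarrow> 'a::real_inner \<Rightarrow> real) \<Rightarrow> 'a \<Rightarrow> 'a \<Rightarrow> ('i \<Rightarrow> 'a) \<Rightarrow> real"
  where "penalised \<tau> c I h a x y =
    \<tau> * ln (\<Sum>i\<in>I. exp (h i (y i) / \<tau>)) + c / 2 * (\<Sum>i\<in>I. (norm (x - y i))\<^sup>2)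
      + (norm (x - a))\<^sup>2 / 2"

text \<open>
  All \<open>y i\<close>, also those with \<open>i \<notin> I\<close>, are confined to the ball, so that the admissible \<open>y\<close> form a full
  product, compact by Tychonoff's theorem.
\<close>
lemma penalised_attains_min:
  fixes \<Omega> :: "'a::euclidean_space set" and h :: "'i \<Rightarrow> 'a \<Rightarrow> real"
  assumes "finite I" "I \<noteq> {}" "closed \<Omega>" "a \<in> \<Omega>" "\<tau> > 0"
    and cont: "\<And>i. i \<in> I \<Longrightarrow> continuous_on (cball a 2) (h i)"
  obtains x y where "x \<in> \<Omega>" "x \<in> cball a 1" "\<And>i. y i \<in> cball a 2"
    and "\<And>x' y'. x' \<in> \<Omega> \<Longrightarrow> x' \<in> cball a 1 \<Longrightarrow> (\<And>i. y' i \<in> cball a 2) \<Longrightarrow>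
      penalised \<tau> c I h a x y \<le> penalised \<tau> c I h a x' y'"
proof -
  define Y where "Y = {y :: 'i \<Rightarrow> 'a. \<forall>i. y i \<in> cball a 2}"
  define K where "K = (\<Omega> \<inter> cball a 1) \<times> Y"
  define E where "E q = penalised \<tau> c I h a (fst q) (snd q)" for q
  have "compact Y" unfolding Y_def by (rule compact_Pi_UNIV) simp
  then have "compact K"
    unfolding K_def using \<open>closed \<Omega>\<close> by (intro compact_Times closed_Int_compact) auto
  moreover have "(a, \<lambda>_. a) \<in> K" using assms by (auto simp: K_def Y_def)
  then have "K \<noteq> {}" by blast
  moreover have "continuous_on K E"
  proof -
    have coord: "continuous_on K (\<lambda>q. snd q i)" for i
    proof -
      have "continuous_on UNIV (\<lambda>y :: 'i \<Rightarrow> 'a. y i)"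
        by (rule continuous_on_product_coordinates)
      from continuous_on_compose2[OF this continuous_on_snd[OF continuous_on_id]]
      show ?thesis by simp
    qed
    have "continuous_on K (\<lambda>q. h i (snd q i))" if "i \<in> I" for i
      by (rule continuous_on_compose2[OF cont[OF that] coord]) (auto simp: K_def Y_def)
    then have "continuous_on K (\<lambda>q. \<Sum>i\<in>I. exp (h i (snd q i) / \<tau>))"
      using \<open>\<tau> > 0\<close>
      by (intro continuous_on_sum continuous_on_exp continuous_on_divide continuous_on_const) auto
    moreover have pos: "0 < (\<Sum>i\<in>I. exp (h i (y i) / \<tau>))" for y
      using assms by (intro sum_pos) auto
    ultimately have "continuous_on K (\<lambda>q. ln (\<Sum>i\<in>I. exp (h i (snd q i) / \<tau>)))"
      by (intro continuous_on_ln) (auto simp: less_imp_neq[OF pos, symmetric])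
    then show ?thesis
      unfolding E_def penalised_def
      by (intro continuous_on_add continuous_on_mult continuous_on_sum continuous_on_power
          continuous_on_norm continuous_on_diff continuous_on_divide continuous_on_const coord
          continuous_on_fst continuous_on_id) auto
  qed
  ultimately obtain q where q: "q \<in> K" "\<And>q'. q' \<in> K \<Longrightarrow> E q \<le> E q'"
    using continuous_attains_inf by metis
  show thesis
  proof (rule that[of "fst q" "snd q"])
    show "penalised \<tau> c I h a (fst q) (snd q) \<le> penalised \<tau> c I h a x' y'"
      if "x' \<in> \<Omega>" "x' \<in> cball a 1" "\<And>i. y' i \<in> cball a 2" for x' y'
      using q(2)[of "(x', y')"] that by (simp add: K_def Y_def E_def)
  qed (use q(1) in \<open>auto simp: K_def Y_def\<close>)
qed

text \<open>
  At the minimiser, some \<open>h i\<close> is nonnegative at \<open>x\<close>, hence at least \<open>- L \<parallel>x - y i\<parallel>\<close> at \<open>y i\<close>. Half of the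
  quadratic penalty absorbs this linear loss up to \<open>L\<^sup>2 / c\<close>. What remains of the penalties is
  bounded by comparison with the value at \<open>x = y i = a\<close>, where they vanish.
\<close>
lemma penalised_min_localised:
  fixes h :: "'i \<Rightarrow> 'a::real_inner \<Rightarrow> real"
  assumes "finite I" "I \<noteq> {}" "\<tau> > 0" "c > 0"
    and lip: "\<And>i. i \<in> I \<Longrightarrow> L-lipschitz_on (cball a 2) (h i)"
    and nonneg: "\<exists>i\<in>I. 0 \<le> h i x"
    and small: "\<And>i. i \<in> I \<Longrightarrow> h i a \<le> \<delta>"
    and x: "x \<in> cball a 1" and y: "\<And>i. y i \<in> cball a 2"
    and min: "penalised \<tau> c I h a x y \<le> penalised \<tau> c I h a a (\<lambda>_. a)"
  shows "c / 4 * (\<Sum>i\<in>I. (norm (x - y i))\<^sup>2) + (norm (x - a))\<^sup>2 / 2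
    \<le> \<delta> + \<tau> * ln (card I) + L\<^sup>2 / c"
proof -
  obtain i where i: "i \<in> I" "0 \<le> h i x" using nonneg by blast
  define r where "r = norm (x - y i)"
  define Q where "Q = (\<Sum>i\<in>I. (norm (x - y i))\<^sup>2)"
  have "r\<^sup>2 \<le> Q"
    unfolding r_def Q_def using i assms(1) by (intro member_le_sum) auto
  then have 1: "c / 4 * r\<^sup>2 \<le> c / 4 * Q" using \<open>c > 0\<close> by (intro mult_left_mono) auto
  have "dist (h i x) (h i (y i)) \<le> L * dist x (y i)"
    using lip[OF i(1)] x y[of i] by (intro lipschitz_onD) auto
  then have 2: "- (L * r) \<le> h i (y i)"
    using i by (simp add: dist_norm r_def)
  have "c * (c / 4 * r\<^sup>2 + L\<^sup>2 / c) - c * (L * r) = (c * r / 2 - L)\<^sup>2"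
    using \<open>c > 0\<close> by (simp add: power2_eq_square field_simps)
  then have "c * (L * r) \<le> c * (c / 4 * r\<^sup>2 + L\<^sup>2 / c)"
    using zero_le_power2[of "c * r / 2 - L"] by linarith
  then have 3: "L * r \<le> c / 4 * r\<^sup>2 + L\<^sup>2 / c"
    using \<open>c > 0\<close> by simp
  have "h i (y i) \<le> \<tau> * ln (\<Sum>i\<in>I. exp (h i (y i) / \<tau>))"
    using le_softmax[of I i \<tau> "\<lambda>i. h i (y i)"] i assms by simp
  then have 4: "h i (y i) + c / 2 * Q + (norm (x - a))\<^sup>2 / 2 \<le> penalised \<tau> c I h a x y"
    by (simp add: penalised_def Q_def)
  have "penalised \<tau> c I h a a (\<lambda>_. a) \<le> \<delta> + \<tau> * ln (card I)"
    using softmax_le[of I \<tau> "\<lambda>i. h i a" \<delta>] assms by (simp add: penalised_def)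
  with 1 2 3 4 min show ?thesis by (simp add: Q_def)
qed

lemma lipschitz_on_cball_eventually:
  assumes "L-lipschitz_on (cball a r) h" and "dist a b < r"
  shows "\<forall>\<^sub>F z in nhds b. \<bar>h z - h b\<bar> \<le> L * norm (z - b)"
proof -
  have "\<forall>\<^sub>F z in nhds b. z \<in> ball a r"
    using assms(2) by (intro eventually_nhds_in_open) auto
  then show ?thesis
  proof (rule eventually_mono)
    fix z assume "z \<in> ball a r"
    then have "dist (h z) (h b) \<le> L * dist z b"
      using assms by (intro lipschitz_onD[OF assms(1)]) auto
    then show "\<bar>h z - h b\<bar> \<le> L * norm (z - b)" by (simp add: dist_norm)
  qed
qed

text \<open>
  With \<open>y\<close> fixed, the objective is a quadratic function of \<open>x\<close>; minus its gradient is normal to \<open>\<Omega>\<close>.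
  The strict inequality \<open>dist a x < 1\<close> lets every nearby point of \<open>\<Omega>\<close> compete with \<open>x\<close>.
\<close>
lemma penalised_min_normal:
  fixes \<Omega> :: "'a::real_inner set"
  assumes "dist a x < 1"
    and min: "\<And>x'. x' \<in> \<Omega> \<Longrightarrow> x' \<in> cball a 1 \<Longrightarrow> penalised \<tau> c I h a x y \<le> penalised \<tau> c I h a x' y"
  shows "- (\<Sum>i\<in>I. c *\<^sub>R (x - y i)) - (x - a) \<in> frechet_normal_cone \<Omega> x"
proof (rule proximal_normal_in_frechet_normal_cone)
  have "\<forall>\<^sub>F w in nhds x. w \<in> ball a 1"
    using assms(1) by (intro eventually_nhds_in_open) auto
  then show "\<forall>\<^sub>F w in nhds x. w \<in> \<Omega> \<longrightarrow> (- (\<Sum>i\<in>I. c *\<^sub>R (x - y i)) - (x - a)) \<bullet> (w - x)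
      \<le> (c / 2 * card I + 1 / 2) * (norm (w - x))\<^sup>2"
  proof (rule eventually_mono, intro impI)
    fix w assume w: "w \<in> ball a 1" "w \<in> \<Omega>"
    define P where "P = (\<Sum>i\<in>I. (x - y i) \<bullet> (w - x))"
    have "(- (\<Sum>i\<in>I. c *\<^sub>R (x - y i)) - (x - a)) \<bullet> (w - x) = - (c * P) - (x - a) \<bullet> (w - x)"
      by (simp only: P_def inner_diff_left inner_minus_left inner_sum_left inner_scaleR_left
          sum_distrib_left)
    moreover
    have "(\<Sum>i\<in>I. (norm (w - y i))\<^sup>2)
        = (\<Sum>i\<in>I. (norm (x - y i))\<^sup>2) + 2 * P + card I * (norm (w - x))\<^sup>2"
      by (subst norm_diff_square_expansion[of _ _ x]) (simp add: P_def sum.distrib sum_distrib_left)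
    with min[of w] w have "0 \<le> c * P + c / 2 * card I * (norm (w - x))\<^sup>2
        + (x - a) \<bullet> (w - x) + (norm (w - x))\<^sup>2 / 2"
      by (simp add: penalised_def norm_diff_square_expansion[of w a x] field_simps)
    ultimately show "(- (\<Sum>i\<in>I. c *\<^sub>R (x - y i)) - (x - a)) \<bullet> (w - x)
      \<le> (c / 2 * card I + 1 / 2) * (norm (w - x))\<^sup>2"
      by (simp add: algebra_simps)
  qed
qed

text \<open>
  With everything but \<open>y i\<close> fixed, the objective is \<open>q (h i z) + c/2 \<parallel>x - z\<parallel>\<^sup>2\<close> plus a constant, where \<open>q\<close>
  is log-sum-exp in one argument and has the softmax weight as its derivative.
\<close>
lemma penalised_min_subgradient:
  fixes h :: "'i \<Rightarrow> 'a::real_inner \<Rightarrow> real"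
  assumes "finite I" "i \<in> I" "\<tau> > 0"
    and lip: "L-lipschitz_on (cball a 2) (h i)"
    and "dist a (y i) < 2"
    and min: "\<And>z. z \<in> cball a 2 \<Longrightarrow> penalised \<tau> c I h a x y \<le> penalised \<tau> c I h a x (y(i := z))"
  shows "frechet_subgradient (h i) (y i)
    ((c *\<^sub>R (x - y i)) /\<^sub>R (exp (h i (y i) / \<tau>) / (\<Sum>j\<in>I. exp (h j (y j) / \<tau>))))"
proof -
  define C where "C = (\<Sum>j\<in>I - {i}. exp (h j (y j) / \<tau>))"
  define q where "q s = \<tau> * ln (exp (s / \<tau>) + C)" for s
  have "C \<ge> 0" unfolding C_def by (intro sum_nonneg) auto
  have pos: "exp s + C > 0" for s using \<open>C \<ge> 0\<close> by (simp add: add_pos_nonneg)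
  have S: "(\<Sum>j\<in>I. exp (h j (y j) / \<tau>)) = exp (h i (y i) / \<tau>) + C"
    unfolding C_def using assms by (simp add: sum.remove)
  have "(q has_real_derivative exp (h i (y i) / \<tau>) / (exp (h i (y i) / \<tau>) + C)) (at (h i (y i)))"
    unfolding q_def using pos[of "h i (y i) / \<tau>"] \<open>\<tau> > 0\<close>
    by (auto intro!: derivative_eq_intros)
  moreover have "exp (h i (y i) / \<tau>) / (exp (h i (y i) / \<tau>) + C) > 0"
    using pos by simp
  moreover note lipschitz_on_cball_eventually[OF lip \<open>dist a (y i) < 2\<close>]
  moreover have "L \<ge> 0" using lip by (rule lipschitz_on_nonneg)
  moreover have "frechet_subgradient (\<lambda>z. q (h i z)) (y i) (c *\<^sub>R (x - y i))"
  proof (rule proximal_subgradient_imp_frechet_subgradient)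
    have "\<forall>\<^sub>F z in nhds (y i). z \<in> ball a 2"
      using assms by (intro eventually_nhds_in_open) auto
    then show "\<forall>\<^sub>F z in nhds (y i). c *\<^sub>R (x - y i) \<bullet> (z - y i) - c / 2 * (norm (z - y i))\<^sup>2
        \<le> q (h i z) - q (h i (y i))"
    proof (rule eventually_mono)
      fix z assume z: "z \<in> ball a 2"
      have split: "penalised \<tau> c I h a x (y(i := z)) = q (h i z) + c / 2 * (norm (x - z))\<^sup>2
          + (c / 2 * (\<Sum>j\<in>I - {i}. (norm (x - y j))\<^sup>2) + (norm (x - a))\<^sup>2 / 2)" for z
      proof -
        have "(\<Sum>j\<in>I. exp (h j ((y(i := z)) j) / \<tau>)) = exp (h i z / \<tau>) + C"
          unfolding C_def using assms by (simp add: sum.remove[of I i])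
        moreover have "(\<Sum>j\<in>I. (norm (x - (y(i := z)) j))\<^sup>2)
            = (norm (x - z))\<^sup>2 + (\<Sum>j\<in>I - {i}. (norm (x - y j))\<^sup>2)"
          using assms by (simp add: sum.remove[of I i])
        ultimately show ?thesis by (simp only: penalised_def q_def) (simp add: algebra_simps)
      qed
      have "penalised \<tau> c I h a x (y(i := y i)) \<le> penalised \<tau> c I h a x (y(i := z))"
        using z min[of z] by simp
      then have "q (h i (y i)) + c / 2 * (norm (y i - x))\<^sup>2 \<le> q (h i z) + c / 2 * (norm (z - x))\<^sup>2"
        unfolding split by (simp add: norm_minus_commute)
      then show "c *\<^sub>R (x - y i) \<bullet> (z - y i) - c / 2 * (norm (z - y i))\<^sup>2
          \<le> q (h i z) - q (h i (y i))"
        unfolding norm_diff_square_expansion[of z x "y i"]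
        by (simp add: inner_diff_left algebra_simps)
    qed
  qed
  ultimately show ?thesis
    unfolding S by (rule frechet_subgradient_outer_derivative)
qed

text \<open>
  A Fermat rule for the maximum of the \<open>h i\<close> over \<open>\<Omega>\<close>, stated at points near an approximate minimiser
  \<open>a\<close>: its value there is at most \<open>\<epsilon>\<^sup>2 / 6\<close>, while it is nonnegative on all of \<open>\<Omega>\<close>.
\<close>
lemma approximate_multiplier_rule:
  fixes \<Omega> :: "'a::euclidean_space set" and h :: "'i \<Rightarrow> 'a \<Rightarrow> real"
  assumes "finite I" "I \<noteq> {}" "closed \<Omega>" "a \<in> \<Omega>" "0 < \<epsilon>" "\<epsilon> < 1"
    and lip: "\<And>i. i \<in> I \<Longrightarrow> L-lipschitz_on (cball a 2) (h i)"
    and nonneg: "\<And>x. x \<in> \<Omega> \<Longrightarrow> \<exists>i\<in>I. 0 \<le> h i x"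
    and small: "\<And>i. i \<in> I \<Longrightarrow> h i a \<le> \<epsilon>\<^sup>2 / 6"
  obtains x y l u v where
    "x \<in> \<Omega>" "dist a x \<le> \<epsilon>" "v \<in> frechet_normal_cone \<Omega> x"
    "\<And>i. i \<in> I \<Longrightarrow> dist a (y i) \<le> 2"
    "\<And>i. i \<in> I \<Longrightarrow> 0 \<le> l i" "(\<Sum>i\<in>I. l i) = (1::real)"
    "\<And>i. i \<in> I \<Longrightarrow> frechet_subgradient (h i) (y i) (u i)"
    "\<And>i. i \<in> I \<Longrightarrow> norm (u i) \<le> L"
    "norm ((\<Sum>i\<in>I. l i *\<^sub>R u i) + v) \<le> \<epsilon>"
proof -
  \<comment> \<open>\<open>\<tau>\<close> and \<open>c\<close> are chosen so that each of the three error terms of \<open>penalised_min_localised\<close> is at most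
    \<open>\<epsilon>\<^sup>2 / 6\<close>. The summand \<open>1\<close> avoids division by zero when \<open>I\<close> is a singleton; the summand \<open>2\<close> gives
    \<open>c / 4 \<ge> 1 / 2\<close>, so that both penalties are controlled by the same bound.\<close>
  define \<tau> where "\<tau> = \<epsilon>\<^sup>2 / (6 * (ln (card I) + 1))"
  define c where "c = 6 * L\<^sup>2 / \<epsilon>\<^sup>2 + 2"
  have card: "ln (real (card I)) \<ge> 0"
    using assms(1,2) by (intro ln_ge_zero) (simp add: Suc_le_eq card_gt_0_iff)
  have \<tau>: "\<tau> > 0" "\<tau> * ln (card I) \<le> \<epsilon>\<^sup>2 / 6"
    using card \<open>0 < \<epsilon>\<close> by (auto simp: \<tau>_def field_simps)
  have c: "c > 0" "c \<ge> 2"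
    by (auto simp: c_def intro!: add_nonneg_pos)
  have cL: "L\<^sup>2 / c \<le> \<epsilon>\<^sup>2 / 6"
    using \<open>0 < \<epsilon>\<close> c(1) by (simp add: divide_le_eq) (simp add: c_def field_simps)
  obtain x y where x: "x \<in> \<Omega>" "x \<in> cball a 1" and y: "\<And>i. y i \<in> cball a 2"
    and min: "\<And>x' y'. x' \<in> \<Omega> \<Longrightarrow> x' \<in> cball a 1 \<Longrightarrow> (\<And>i. y' i \<in> cball a 2) \<Longrightarrow>
      penalised \<tau> c I h a x y \<le> penalised \<tau> c I h a x' y'"
    using penalised_attains_min[OF assms(1-4) \<tau>(1), of h c] lip lipschitz_on_continuous_on
    by metis
  define Q where "Q = (\<Sum>i\<in>I. (norm (x - y i))\<^sup>2)"
  have "c / 4 * Q + (norm (x - a))\<^sup>2 / 2 \<le> \<epsilon>\<^sup>2 / 6 + \<tau> * ln (card I) + L\<^sup>2 / c"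
    unfolding Q_def
    by (rule penalised_min_localised[OF assms(1,2) \<tau>(1) c(1) lip nonneg[OF x(1)] small x(2) y])
      (use min[of a "\<lambda>_. a"] assms in auto)
  then have bound: "c / 4 * Q + (norm (x - a))\<^sup>2 / 2 \<le> \<epsilon>\<^sup>2 / 2"
    using \<tau> cL by linarith
  have "Q \<ge> 0" unfolding Q_def by (intro sum_nonneg) auto
  then have "1 / 2 * Q \<le> c / 4 * Q" using c by (intro mult_right_mono) auto
  then have Q: "Q \<le> \<epsilon>\<^sup>2" and "(norm (x - a))\<^sup>2 \<le> \<epsilon>\<^sup>2"
    using bound \<open>Q \<ge> 0\<close> zero_le_power2[of "norm (x - a)"] by linarith+
  then have xa: "norm (x - a) \<le> \<epsilon>"
    using power2_le_imp_le \<open>0 < \<epsilon>\<close> less_imp_le by blast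
  have yx: "norm (x - y i) \<le> \<epsilon>" if "i \<in> I" for i
  proof -
    have "(norm (x - y i))\<^sup>2 \<le> Q" unfolding Q_def using that assms(1) by (intro member_le_sum) auto
    then have "(norm (x - y i))\<^sup>2 \<le> \<epsilon>\<^sup>2" using Q by (rule order_trans)
    then show ?thesis using power2_le_imp_le \<open>0 < \<epsilon>\<close> less_imp_le by blast
  qed
  have ya: "dist a (y i) < 2" if "i \<in> I" for i
    using dist_triangle[of a "y i" x] xa yx[OF that] \<open>\<epsilon> < 1\<close> by (simp add: dist_norm norm_minus_commute)
  define S where "S = (\<Sum>j\<in>I. exp (h j (y j) / \<tau>))"
  define l where "l i = exp (h i (y i) / \<tau>) / S" for i
  define u where "u i = (c *\<^sub>R (x - y i)) /\<^sub>R l i" for i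
  define v where "v = - (\<Sum>i\<in>I. c *\<^sub>R (x - y i)) - (x - a)"
  have "S > 0" unfolding S_def using assms by (intro sum_pos) auto
  then have l: "l i > 0" for i by (simp add: l_def)
  have sub: "frechet_subgradient (h i) (y i) (u i)" if "i \<in> I" for i
    unfolding u_def l_def S_def
    using that ya[OF that] lip[OF that] assms(1) \<tau>(1) x y
    by (intro penalised_min_subgradient[where a = a and L = L] min) auto
  have "l i *\<^sub>R u i = c *\<^sub>R (x - y i)" for i
    using l[of i] by (simp add: u_def)
  then have "(\<Sum>i\<in>I. l i *\<^sub>R u i) + v = - (x - a)" by (simp add: v_def)
  moreover have "norm (- (x - a)) \<le> \<epsilon>" using xa by (metis norm_minus_cancel)
  ultimately have e: "norm ((\<Sum>i\<in>I. l i *\<^sub>R u i) + v) \<le> \<epsilon>" by simp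
  show thesis
  proof (rule that[of x v y l u])
    show "v \<in> frechet_normal_cone \<Omega> x"
      unfolding v_def using xa \<open>\<epsilon> < 1\<close> x y
      by (intro penalised_min_normal[where \<tau> = \<tau> and h = h] min) (auto simp: dist_norm norm_minus_commute)
    show "(\<Sum>i\<in>I. l i) = 1"
      using \<open>S > 0\<close> by (simp add: l_def flip: sum_divide_distrib S_def)
    show "norm (u i) \<le> L" if "i \<in> I" for i
      using lip[OF that] lipschitz_on_nonneg
      by (intro frechet_subgradient_norm_le[OF sub[OF that] lipschitz_on_cball_eventually[OF lip ya]] that) auto
  qed (use x xa ya l sub e in \<open>auto simp: dist_norm norm_minus_commute less_imp_le\<close>)
qed

section \<open>Passing to infinity\<close>

lemma finite_family_convergent_subsequence:
  fixes z :: "'i \<Rightarrow> nat \<Rightarrow> 'b::heine_borel"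
  assumes "finite I" and "\<And>i. i \<in> I \<Longrightarrow> bounded (range (z i))"
  shows "\<exists>(r :: nat \<Rightarrow> nat) zlim. strict_mono r \<and> (\<forall>i\<in>I. (z i \<circ> r) \<longlonglongrightarrow> zlim i)"
  using assms
proof (induction I rule: finite_induct)
  case empty
  show ?case by (intro exI[of _ id]) (simp add: strict_mono_def)
next
  case (insert i I)
  then obtain r zlim where r: "strict_mono r" "\<And>j. j \<in> I \<Longrightarrow> (z j \<circ> r) \<longlonglongrightarrow> zlim j"
    by blast
  have "bounded (range (z i \<circ> r))"
    by (rule bounded_subset[OF insert.prems[of i]]) auto
  then obtain s l where s: "strict_mono s" "((z i \<circ> r) \<circ> s) \<longlonglongrightarrow> l"
    using bounded_imp_convergent_subsequence by metis
  have "(z j \<circ> (r \<circ> s)) \<longlonglongrightarrow> (zlim(i := l)) j" if "j \<in> insert i I" for j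
  proof (cases "j = i")
    case True
    then show ?thesis using s(2) by (simp add: o_assoc)
  next
    case False
    then have "((z j \<circ> r) \<circ> s) \<longlonglongrightarrow> zlim j"
      using that by (intro LIMSEQ_subseq_LIMSEQ[OF r(2) s(1)]) auto
    then show ?thesis using False by (simp add: o_assoc)
  qed
  then show ?case
    using strict_mono_o[OF r(1) s(1)] by blast
qed

lemma common_lipschitz_at_infinity:
  assumes "finite I" and "\<And>i. i \<in> I \<Longrightarrow> lipschitz_at_infinity (h i)"
  obtains L R :: real where "\<And>i. i \<in> I \<Longrightarrow> L-lipschitz_on (- cball 0 R) (h i)"
proof -
  have "\<forall>i\<in>I. \<exists>L R. L > 0 \<and> R > 0 \<and> L-lipschitz_on (- cball 0 R) (h i)"
    using assms(2) unfolding lipschitz_at_infinity_def by blast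
  then obtain L R :: "_ \<Rightarrow> real" where
    LR: "\<And>i. i \<in> I \<Longrightarrow> L i > 0 \<and> R i > 0 \<and> (L i)-lipschitz_on (- cball 0 (R i)) (h i)"
    by metis
  show thesis
  proof (rule that[of "sum L I" "sum R I"])
    fix i assume "i \<in> I"
    have "L i \<le> sum L I" "R i \<le> sum R I"
      by (intro member_le_sum; use LR \<open>i \<in> I\<close> assms(1) in force)+
    then have "- cball 0 (sum R I) \<subseteq> - cball 0 (R i)" by auto
    with LR[OF \<open>i \<in> I\<close>] \<open>L i \<le> sum L I\<close>
    show "(sum L I)-lipschitz_on (- cball 0 (sum R I)) (h i)"
      by (metis lipschitz_on_mono)
  qed
qed

lemma filterlim_norm_ge_real:
  assumes "\<And>k. real k \<le> norm (x k)"
  shows "filterlim (\<lambda>k. norm (x k)) at_top sequentially"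
  by (rule filterlim_at_top_mono[OF filterlim_real_sequentially]) (use assms in auto)

lemma frechet_subgradient_diff_const:
  "frechet_subgradient (\<lambda>x. h x - b) a u \<longleftrightarrow> frechet_subgradient h a u"
  by (simp add: frechet_subgradient_def)

text \<open>
  The levels \<open>b i\<close> and the functions \<open>h i\<close> are kept apart because subtracting \<open>b i\<close> is harmless for
  \<open>frechet_subgradient\<close>, whereas the subdifferential at infinity would have to be compared through
  translated epigraphs. Multipliers and subgradients are made to converge separately, not just their
  products: an index whose limiting multiplier is \<open>0\<close> still needs an element of the subdifferential at
  infinity, since \<open>0\<close> times the empty set is empty.
\<close>
theorem multiplier_rule_at_infinity:
  fixes \<Omega> :: "'a::euclidean_space set" and h :: "'i \<Rightarrow> 'a \<Rightarrow> real"
  assumes "finite I" "I \<noteq> {}" "closed \<Omega>"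
    and lip: "\<And>i. i \<in> I \<Longrightarrow> lipschitz_at_infinity (h i)"
    and above: "\<And>x. x \<in> \<Omega> \<Longrightarrow> \<exists>i\<in>I. b i \<le> h i x"
    and x: "\<And>k. x k \<in> \<Omega>" "filterlim (\<lambda>k. norm (x k)) at_top sequentially"
    and approx: "\<And>i e. i \<in> I \<Longrightarrow> e > 0 \<Longrightarrow> \<forall>\<^sub>F k in sequentially. h i (x k) \<le> b i + e"
  shows "\<exists>l u. \<exists>v\<in>normal_cone_at_infinity \<Omega>.
    (\<forall>i\<in>I. 0 \<le> l i \<and> u i \<in> subdifferential_at_infinity (h i)) \<and>
    (\<Sum>i\<in>I. l i) = (1::real) \<and> (\<Sum>i\<in>I. l i *\<^sub>R u i) + v = 0"
proof -
  obtain L R where LR: "\<And>i. i \<in> I \<Longrightarrow> L-lipschitz_on (- cball 0 R) (h i)"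
    using common_lipschitz_at_infinity[OF assms(1), of h] lip by metis
  define P where "P k w y l u v \<longleftrightarrow> w \<in> \<Omega> \<and> real k \<le> norm w \<and> v \<in> frechet_normal_cone \<Omega> w \<and>
      (\<forall>i\<in>I. real k \<le> norm (y i) \<and> 0 \<le> l i \<and> frechet_subgradient (h i) (y i) (u i) \<and> norm (u i) \<le> L) \<and>
      (\<Sum>i\<in>I. l i) = (1::real) \<and> norm ((\<Sum>i\<in>I. l i *\<^sub>R u i) + v) \<le> 1 / (real k + 2)"
    for k :: nat and w y l u v
  have "\<exists>w y l u v. P k w y l u v" for k
  proof -
    define \<epsilon> where "\<epsilon> = 1 / (real k + 2)"
    have \<epsilon>: "0 < \<epsilon>" "\<epsilon> < 1" by (auto simp: \<epsilon>_def)
    \<comment> \<open>The ball of radius \<open>2\<close> about \<open>x n\<close> must avoid \<open>cball 0 R\<close> and stay at distance \<open>k\<close> from \<open>0\<close>.\<close>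
    have "\<forall>\<^sub>F n in sequentially. \<bar>R\<bar> + 3 + real k \<le> norm (x n)"
      using x(2) by (auto simp: filterlim_at_top)
    moreover have "\<forall>\<^sub>F n in sequentially. \<forall>i\<in>I. h i (x n) \<le> b i + \<epsilon>\<^sup>2 / 6"
      using \<epsilon> assms(1) approx by (intro eventually_ball_finite) auto
    ultimately have "\<forall>\<^sub>F n in sequentially. \<bar>R\<bar> + 3 + real k \<le> norm (x n) \<and>
        (\<forall>i\<in>I. h i (x n) \<le> b i + \<epsilon>\<^sup>2 / 6)"
      by eventually_elim auto
    then obtain n where n: "\<bar>R\<bar> + 3 + real k \<le> norm (x n)"
      "\<And>i. i \<in> I \<Longrightarrow> h i (x n) \<le> b i + \<epsilon>\<^sup>2 / 6"
      using eventually_happens'[OF sequentially_bot] by blast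
    have far: "\<bar>R\<bar> + 1 + real k \<le> norm z" if "dist (x n) z \<le> 2" for z
      using n(1) that norm_triangle_sub[of "x n" z] by (simp add: dist_norm)
    have lip': "L-lipschitz_on (cball (x n) 2) (\<lambda>z. h i z - b i)" if "i \<in> I" for i
    proof -
      have "cball (x n) 2 \<subseteq> - cball 0 R" 
      proof
        fix z assume "z \<in> cball (x n) 2"
        then show "z \<in> - cball 0 R" using far[of z] by simp
      qed
      then have "L-lipschitz_on (cball (x n) 2) (h i)"
        using LR[OF that] lipschitz_on_subset by blast
      then show ?thesis by (simp add: lipschitz_on_def dist_norm)
    qed
    have above': "\<exists>i\<in>I. 0 \<le> h i z - b i" if "z \<in> \<Omega>" for z
      using above[OF that] by simp
    have approx': "h i (x n) - b i \<le> \<epsilon>\<^sup>2 / 6" if "i \<in> I" for i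
      using n(2)[OF that] by simp
    show ?thesis
    proof (rule approximate_multiplier_rule[OF assms(1-3) x(1)[of n] \<epsilon> lip' above' approx'])
      fix w y l u v
      assume w: "w \<in> \<Omega>" "dist (x n) w \<le> \<epsilon>" "v \<in> frechet_normal_cone \<Omega> w"
        "\<And>i. i \<in> I \<Longrightarrow> dist (x n) (y i) \<le> 2"
        "\<And>i. i \<in> I \<Longrightarrow> 0 \<le> l i" "(\<Sum>i\<in>I. l i) = (1::real)"
        "\<And>i. i \<in> I \<Longrightarrow> frechet_subgradient (\<lambda>z. h i z - b i) (y i) (u i)"
        "\<And>i. i \<in> I \<Longrightarrow> norm (u i) \<le> L"
        "norm ((\<Sum>i\<in>I. l i *\<^sub>R u i) + v) \<le> \<epsilon>"
      have "real k \<le> norm w" using far[of w] w(2) \<epsilon> by linarith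
      moreover have "real k \<le> norm (y i)" if "i \<in> I" for i
        using far[of "y i"] w(4)[OF that] by linarith
      ultimately have "P k w y l u v"
        using w by (simp add: P_def \<epsilon>_def frechet_subgradient_diff_const)
      then show ?thesis by blast
    qed
  qed
  then obtain w y l u v where P: "\<And>k. P k (w k) (y k) (l k) (u k) (v k)"
    by metis
  have "bounded (range (\<lambda>k. (l k i, u k i)))" if "i \<in> I" for i
  proof -
    have "(l k i, u k i) \<in> cball 0 1 \<times> cball 0 L" for k
    proof -
      have "l k i \<le> (\<Sum>i\<in>I. l k i)"
        using that assms(1) P[of k] by (intro member_le_sum) (auto simp: P_def)
      then show ?thesis using that P[of k] by (simp add: P_def)
    qed
    then have "range (\<lambda>k. (l k i, u k i)) \<subseteq> cball 0 1 \<times> cball 0 L" by blast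
    then show ?thesis
      by (rule bounded_subset[OF bounded_Times[OF bounded_cball bounded_cball]])
  qed
  from finite_family_convergent_subsequence[of I "\<lambda>i k. (l k i, u k i)", OF assms(1) this]
  obtain r and q :: "'i \<Rightarrow> real \<times> 'a" where r: "strict_mono r"
    and q: "\<And>i. i \<in> I \<Longrightarrow> ((\<lambda>k. (l k i, u k i)) \<circ> r) \<longlonglongrightarrow> q i"
    by blast
  have l: "(\<lambda>k. l (r k) i) \<longlonglongrightarrow> fst (q i)" and u: "(\<lambda>k. u (r k) i) \<longlonglongrightarrow> snd (q i)" if "i \<in> I" for i
    using tendsto_fst[OF q[OF that]] tendsto_snd[OF q[OF that]] by (simp_all add: o_def)
  have rk: "real k \<le> real (r k)" for k using seq_suble[OF r] by simp
  have w: "filterlim (\<lambda>k. norm (w (r k))) at_top sequentially"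
    using P rk by (intro filterlim_norm_ge_real) (meson P_def order_trans)
  have y: "filterlim (\<lambda>k. norm (y (r k) i)) at_top sequentially" if "i \<in> I" for i
    using P rk that by (intro filterlim_norm_ge_real) (meson P_def order_trans)
  define S where "S k = (\<Sum>i\<in>I. l (r k) i *\<^sub>R u (r k) i)" for k
  have S: "S \<longlonglongrightarrow> (\<Sum>i\<in>I. fst (q i) *\<^sub>R snd (q i))"
    unfolding S_def by (intro tendsto_sum tendsto_scaleR l u)
  have "(\<lambda>k. S k + v (r k)) \<longlonglongrightarrow> 0"
  proof (rule Lim_null_comparison)
    have "norm (S k + v (r k)) \<le> 1 / real (Suc k)" for k
    proof -
      have "norm (S k + v (r k)) \<le> 1 / (real (r k) + 2)"
        using P[of "r k"] by (simp add: P_def S_def)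
      also have "\<dots> \<le> 1 / real (Suc k)"
        using rk[of k] by (intro divide_left_mono) auto
      finally show ?thesis .
    qed
    then show "\<forall>\<^sub>F k in sequentially. norm (S k + v (r k)) \<le> 1 / real (Suc k)" by simp
    show "(\<lambda>k. 1 / real (Suc k)) \<longlonglongrightarrow> 0"
      using LIMSEQ_inverse_real_of_nat by (simp add: inverse_eq_divide)
  qed
  from tendsto_diff[OF this S]
  have v: "(\<lambda>k. v (r k)) \<longlonglongrightarrow> - (\<Sum>i\<in>I. fst (q i) *\<^sub>R snd (q i))" by simp
  have "0 \<le> fst (q i)" if "i \<in> I" for i
    using l[OF that] P that by (intro LIMSEQ_le_const) (auto simp: P_def)
  moreover have "(\<lambda>k. \<Sum>i\<in>I. l (r k) i) \<longlonglongrightarrow> (\<Sum>i\<in>I. fst (q i))"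
    by (intro tendsto_sum l)
  then have "(\<Sum>i\<in>I. fst (q i)) = 1"
    using P by (simp add: P_def LIMSEQ_const_iff)
  moreover have "snd (q i) \<in> subdifferential_at_infinity (h i)" if "i \<in> I" for i
    using P that by (intro subdifferential_at_infinityI[OF _ y u]) (auto simp: P_def)
  moreover have "\<forall>k. w (r k) \<in> \<Omega> \<and> v (r k) \<in> frechet_normal_cone \<Omega> (w (r k))"
    using P by (simp add: P_def)
  then have "- (\<Sum>i\<in>I. fst (q i) *\<^sub>R snd (q i)) \<in> normal_cone_at_infinity \<Omega>"
    unfolding normal_cone_at_infinity_def mem_Collect_eq using w v
    by (intro exI[of _ "\<lambda>k. w (r k)"] exI[of _ "\<lambda>k. v (r k)"]) simp
  ultimately show ?thesis
    by (intro exI[of _ "\<lambda>i. fst (q i)"] exI[of _ "\<lambda>i. snd (q i)"]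
        bexI[of _ "- (\<Sum>i\<in>I. fst (q i) *\<^sub>R snd (q i))"]) simp_all
qed

lemma interior_nonneg_orthantI:
  fixes z :: "real ^ 'm"
  assumes "\<And>i. 0 < z $ i"
  shows "z \<in> interior nonneg_orthant"
proof -
  have "open (\<Inter>i. {z :: real ^ 'm. 0 < z $ i})"
    by (intro open_INT ballI open_Collect_less continuous_intros) simp
  then have "open {z :: real ^ 'm. \<forall>i. 0 < z $ i}"
    by (simp add: Collect_all_eq)
  moreover have "{z :: real ^ 'm. \<forall>i. 0 < z $ i} \<subseteq> nonneg_orthant"
    by (auto simp: nonneg_orthant_def less_imp_le)
  ultimately show ?thesis using assms interior_maximal by blast
qed

lemma weighted_sum_in_set_sum:
  assumes "finite I" and "\<And>i. i \<in> I \<Longrightarrow> u i \<in> A i"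
  shows "(\<Sum>i\<in>I. l i *\<^sub>R u i) \<in> (\<Sum>i\<in>I. set_scale (l i) (A i))"
  unfolding set_sum_alt[OF assms(1)] using assms(2)
  by (intro CollectI exI[of _ "\<lambda>i. l i *\<^sub>R u i"]) auto

theorem theorem4p1:
  fixes \<Omega> :: "(real ^ 'n) set"
    and f :: "'m::finite \<Rightarrow> real ^ 'n \<Rightarrow> real"
    and p :: nat
    and g :: "nat \<Rightarrow> real ^ 'n \<Rightarrow> real"
    and ybar :: "real ^ 'm"
  assumes "\<Omega> \<noteq> {}" and "closed \<Omega>"
    and "\<And>i. lower_semicontinuous (f i)" and "\<And>i. lipschitz_at_infinity (f i)"
    and "\<And>j. j \<in> {1..p} \<Longrightarrow> lower_semicontinuous (g j)"
    and "\<And>j. j \<in> {1..p} \<Longrightarrow> lipschitz_at_infinity (g j)"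
    and "feasible_set \<Omega> p g \<noteq> {}" and "\<not> bounded (feasible_set \<Omega> p g)"
    and "bdd_below ((\<lambda>x. Max (range (\<lambda>i. f i x))) ` feasible_set \<Omega> p g)"
    and "weak_pareto_value (\<lambda>x. \<chi> i. f i x) (feasible_set \<Omega> p g) ybar"
    and "cq_at_infinity \<Omega> p g"
    and "\<exists>x :: nat \<Rightarrow> real ^ 'n. (\<forall>k. x k \<in> feasible_set \<Omega> p g) \<and>
           filterlim (\<lambda>k. norm (x k)) at_top sequentially \<and>
           (\<lambda>k. \<chi> i. f i (x k)) \<longlonglongrightarrow> ybar"
  shows "\<exists>(\<alpha> :: real ^ 'm) (\<beta> :: nat \<Rightarrow> real).
           \<alpha> \<in> nonneg_orthant - {0} \<and> (\<forall>j\<in>{1..p}. 0 \<le> \<beta> j) \<and>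
           0 \<in> (\<Sum>i\<in>UNIV. set_scale (\<alpha> $ i) (subdifferential_at_infinity (f i)))
               + (\<Sum>j\<in>{1..p}. set_scale (\<beta> j) (subdifferential_at_infinity (g j)))
               + normal_cone_at_infinity \<Omega>"
proof -
  let ?F = "feasible_set \<Omega> p g"
  obtain x where x: "\<And>k. x k \<in> ?F" "filterlim (\<lambda>k. norm (x k)) at_top sequentially"
    and lim: "(\<lambda>k. \<chi> i. f i (x k)) \<longlonglongrightarrow> ybar"
    using assms(12) by blast
  \<comment> \<open>Objectives, at the levels \<open>ybar $ i\<close>, and constraints, at level \<open>0\<close>, form a single family.\<close>
  define I where "I = (UNIV :: 'm set) <+> {1..p}"
  define h where "h = case_sum f g"
  define b :: "'m + nat \<Rightarrow> real" where "b = case_sum (\<lambda>i. ybar $ i) (\<lambda>_. 0)"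
  have I: "finite I" "I \<noteq> {}" by (auto simp: I_def)
  have Inl: "Inl i \<in> I" for i by (simp add: I_def InlI)
  have Inr: "Inr j \<in> I" if "j \<in> {1..p}" for j using that by (simp add: I_def InrI)
  have above: "\<exists>i\<in>I. b i \<le> h i w" if "w \<in> \<Omega>" for w
  proof (rule ccontr)
    assume "\<not> ?thesis"
    then have lt: "\<And>i. i \<in> I \<Longrightarrow> h i w < b i" by (meson not_le)
    have "f i w < ybar $ i" for i using lt[OF Inl] by (simp add: h_def b_def)
    then have "ybar - (\<chi> i. f i w) \<in> interior nonneg_orthant"
      by (intro interior_nonneg_orthantI) simp
    moreover have "g j w \<le> 0" if "j \<in> {1..p}" for j
      using lt[OF Inr[OF that]] by (simp add: h_def b_def)
    then have "w \<in> ?F" using \<open>w \<in> \<Omega>\<close> by (simp add: feasible_set_def)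
    ultimately have "(\<chi> i. f i w) \<in> (\<lambda>x. \<chi> i. f i x) ` ?F \<inter> (\<lambda>z. ybar - z) ` interior nonneg_orthant"
      by (auto intro!: image_eqI[of _ _ "ybar - (\<chi> i. f i w)"])
    then show False using assms(10) unfolding weak_pareto_value_def by blast
  qed
  have lip: "lipschitz_at_infinity (h i)" if "i \<in> I" for i
    using that assms(4,6) by (auto simp: I_def h_def)
  have approx: "\<forall>\<^sub>F k in sequentially. h i (x k) \<le> b i + e" if "i \<in> I" "e > 0" for i e
  proof (cases i)
    case (Inl j)
    have "(\<lambda>k. f j (x k)) \<longlonglongrightarrow> ybar $ j"
      using tendsto_vec_nth[OF lim, of j] by simp
    then have "\<forall>\<^sub>F k in sequentially. f j (x k) < ybar $ j + e"
      using \<open>e > 0\<close> by (intro order_tendstoD) auto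
    then show ?thesis by eventually_elim (simp add: Inl h_def b_def)
  next
    case (Inr j)
    then have "g j (x k) \<le> 0" for k using x(1)[of k] that by (auto simp: I_def feasible_set_def)
    then have "h i (x k) \<le> b i + e" for k
      using order_trans[OF \<open>g j (x k) \<le> 0\<close>, of e] \<open>e > 0\<close> by (simp add: Inr h_def b_def)
    then show ?thesis by simp
  qed
  have x\<Omega>: "x k \<in> \<Omega>" for k using x(1)[of k] by (simp add: feasible_set_def)
  obtain l u v where
    l: "\<And>i. i \<in> I \<Longrightarrow> 0 \<le> l i" "(\<Sum>i\<in>I. l i) = (1::real)"
    and u: "\<And>i. i \<in> I \<Longrightarrow> u i \<in> subdifferential_at_infinity (h i)"
    and v: "v \<in> normal_cone_at_infinity \<Omega>" "(\<Sum>i\<in>I. l i *\<^sub>R u i) + v = 0"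
    using multiplier_rule_at_infinity[of I \<Omega> h b x, OF I \<open>closed \<Omega>\<close> lip above x\<Omega> x(2) approx]
    by auto
  define \<alpha> :: "real ^ 'm" where "\<alpha> = (\<chi> i. l (Inl i))"
  define \<beta> where "\<beta> j = l (Inr j)" for j
  have \<alpha>0: "0 \<le> \<alpha> $ i" for i using l(1)[OF Inl] by (simp add: \<alpha>_def)
  have \<beta>0: "0 \<le> \<beta> j" if "j \<in> {1..p}" for j using l(1)[OF Inr[OF that]] by (simp add: \<beta>_def)
  have one: "(\<Sum>i\<in>UNIV. \<alpha> $ i) + (\<Sum>j\<in>{1..p}. \<beta> j) = 1"
    using l(2) by (simp add: I_def sum.Plus \<alpha>_def \<beta>_def o_def)
  have zero: "(\<Sum>i\<in>UNIV. (\<alpha> $ i) *\<^sub>R u (Inl i)) + (\<Sum>j\<in>{1..p}. \<beta> j *\<^sub>R u (Inr j)) + v = 0"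
    using v(2) by (simp add: I_def sum.Plus \<alpha>_def \<beta>_def o_def)
  have f: "(\<Sum>i\<in>UNIV. (\<alpha> $ i) *\<^sub>R u (Inl i))
      \<in> (\<Sum>i\<in>UNIV. set_scale (\<alpha> $ i) (subdifferential_at_infinity (f i)))"
    using u[OF Inl] by (intro weighted_sum_in_set_sum) (simp_all add: h_def)
  have g: "(\<Sum>j\<in>{1..p}. \<beta> j *\<^sub>R u (Inr j))
      \<in> (\<Sum>j\<in>{1..p}. set_scale (\<beta> j) (subdifferential_at_infinity (g j)))"
    using u[OF Inr] by (intro weighted_sum_in_set_sum) (simp_all add: h_def)
  \<comment> \<open>Otherwise all the weight is on the constraints, which is what the qualification excludes.\<close>
  have "\<alpha> \<noteq> 0"
  proof
    assume "\<alpha> = 0"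
    then have "(\<Sum>j\<in>{1..p}. \<beta> j) > 0" using one by simp
    moreover have "0 \<in> (\<Sum>j\<in>{1..p}. set_scale (\<beta> j) (subdifferential_at_infinity (g j)))
        + normal_cone_at_infinity \<Omega>"
      using set_plus_intro[OF g v(1)] zero \<open>\<alpha> = 0\<close> by simp
    ultimately show False
      using assms(11) \<beta>0 unfolding cq_at_infinity_def by blast
  qed
  then have "\<alpha> \<in> nonneg_orthant - {0}" using \<alpha>0 by (simp add: nonneg_orthant_def)
  moreover have "0 \<in> (\<Sum>i\<in>UNIV. set_scale (\<alpha> $ i) (subdifferential_at_infinity (f i)))
      + (\<Sum>j\<in>{1..p}. set_scale (\<beta> j) (subdifferential_at_infinity (g j)))
      + normal_cone_at_infinity \<Omega>"
    using set_plus_intro[OF set_plus_intro[OF f g] v(1)] unfolding zero .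
  ultimately show ?thesis using \<beta>0 by blast
qed

end
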